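(* Let $k,d\in\mathbb{N}$, $m^{(d)}=(m_1,\ldots,m_d)\in\mathbb{N}^d$, and let $w\in T(m^{(d)},k)$. Then $$\mathrm{cycdes}(w)\leq\sum_{i\in[d]}\left(\prod_{\ell\in[d],\,\ell\neq i}m_{\ell}\right)\left\lfloor \frac{m_{i}(k-1)}{k}\right\rfloor.$$
   Context: $\mathbb{N}=\{1,2,\ldots\}$ and $[n]=\{1,\ldots,n\}$. An empty product equals $1$. For $m^{(d)}=(m_1,\ldots,m_d)\in\mathbb{N}^d$, an $m^{(d)}$-tensor word over $[k]$ is a function $w\colon[m_1]\times\cdots\times[m_d]\to[k]$; $T(m^{(d)},k)$ denotes the set of all of them. With $e_\ell$ the $\ell$th standard basis vector of $\mathbb{R}^d$, a descent of $w$ is a pair $(i,j)\in([m_1]\times\cdots\times[m_d])^2$ such that $w(i)>w(j)$ and $j=i+e_\ell$ for some $\ell\in[d]$. A cyclic descent of $w$ is a pair $(i,j)\in([m_1]\times\cdots\times[m_d])^2$ such that $w(i)>w(j)$ and, for some $\ell\in[d]$, $i_\ell=m_\ell$, $j_\ell=1$, and $i_r=j_r$ for all $r\in[d]\setminus\{\ell\}$. $\mathrm{cycdes}(w)$ denotes the total number of descents and cyclic descents of $w$. *)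

theory Defs
  imports Complex_Main "HOL-Library.FuncSet"
begin

text \<open>
  A \<open>d\<close>-tuple of natural numbers is a function whose values on \<open>{1..d}\<close> are its coordinates.
  Positions and tensor words are taken as extensional functions, so that each position
  (and each word) is represented by exactly one function and cardinalities are the intended ones.
\<close>

definition positions :: "nat \<Rightarrow> (nat \<Rightarrow> nat) \<Rightarrow> (nat \<Rightarrow> nat) set" where
  "positions d m = (\<Pi>\<^sub>E l\<in>{1..d}. {1..m l})"

definition tensor_words :: "nat \<Rightarrow> (nat \<Rightarrow> nat) \<Rightarrow> nat \<Rightarrow> ((nat \<Rightarrow> nat) \<Rightarrow> nat) set" where
  "tensor_words d m k = positions d m \<rightarrow>\<^sub>E {1..k}"

text \<open>The update \<open>i(l := i l + 1)\<close> is the sum of \<open>i\<close> and the \<open>l\<close>-th standard basis vector.\<close>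

definition descents ::
  "nat \<Rightarrow> (nat \<Rightarrow> nat) \<Rightarrow> ((nat \<Rightarrow> nat) \<Rightarrow> nat) \<Rightarrow> ((nat \<Rightarrow> nat) \<times> (nat \<Rightarrow> nat)) set" where
  "descents d m w =
     {(i, j) \<in> positions d m \<times> positions d m.
        w i > w j \<and> (\<exists>l\<in>{1..d}. j = i(l := i l + 1))}"

definition cyclic_descents ::
  "nat \<Rightarrow> (nat \<Rightarrow> nat) \<Rightarrow> ((nat \<Rightarrow> nat) \<Rightarrow> nat) \<Rightarrow> ((nat \<Rightarrow> nat) \<times> (nat \<Rightarrow> nat)) set" where
  "cyclic_descents d m w =
     {(i, j) \<in> positions d m \<times> positions d m.
        w i > w j \<and>
        (\<exists>l\<in>{1..d}. i l = m l \<and> j l = 1 \<and> (\<forall>r\<in>{1..d} - {l}. i r = j r))}"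

text \<open>
  No pair is counted twice: \<open>j - i\<close> is a standard basis vector for a descent, and a nonpositive
  multiple of one for a cyclic descent.
\<close>

definition cycdes :: "nat \<Rightarrow> (nat \<Rightarrow> nat) \<Rightarrow> ((nat \<Rightarrow> nat) \<Rightarrow> nat) \<Rightarrow> nat" where
  "cycdes d m w = card (descents d m w) + card (cyclic_descents d m w)"

end

theory Submission imports Defs begin

text \<open>
  Group the descents and cyclic descents by the direction \<open>l\<close> in which they move. Those in
  direction \<open>l\<close> lie on the lines parallel to the \<open>l\<close>-th axis, of which there are
  \<open>\<Prod>r\<noteq>l. m r\<close>, and each line is a cyclic word of length \<open>n = m l\<close> over \<open>{1..k}\<close>.

  On one cyclic word with \<open>D\<close> descents, the differences of consecutive letters sum to \<open>0\<close>. A step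
  down contributes at most \<open>-1\<close> and any other step at most \<open>k - 1\<close>, so
  \<open>0 \<le> (n - D) (k - 1) - D\<close>, that is, \<open>k D \<le> n (k - 1)\<close>
  (lemma \<open>permutation_descents_bound\<close>). Since \<open>D\<close> is an integer, the floor
  may be taken on every line before the lines are added up (lemma \<open>card_dir_descents_le\<close>).
\<close>

text \<open>
  A permutation merely reindexes the sum of \<open>f\<close>, so the differences \<open>f (\<sigma> x) - f x\<close> sum to \<open>0\<close>
  whatever the cycle structure of \<open>\<sigma>\<close>. The two cases of the argument (a step down or not) are merged into the pointwise bound
  \<open>f (\<sigma> x) - f x \<le> (k - 1) - k [f (\<sigma> x) < f x]\<close>.
\<close>

lemma permutation_descents_bound:
  fixes f :: "'a \<Rightarrow> nat"
  assumes fin: "finite S" and bij: "bij_betw \<sigma> S S" and f: "f \<in> S \<rightarrow> {1..k}"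
  shows "int k * int (card {x \<in> S. f x > f (\<sigma> x)}) \<le> int (card S) * (int k - 1)"
proof -
  let ?D = "{x \<in> S. f x > f (\<sigma> x)}"
  have "(\<Sum>x\<in>S. int (f (\<sigma> x))) = (\<Sum>x\<in>S. int (f x))"
    by (rule sum.reindex_bij_betw[OF bij])
  then have "0 = (\<Sum>x\<in>S. int (f (\<sigma> x)) - int (f x))"
    by (simp add: sum_subtractf)
  also have "\<dots> \<le> (\<Sum>x\<in>S. (int k - 1) - (if f x > f (\<sigma> x) then int k else 0))"
  proof (rule sum_mono)
    fix x assume x: "x \<in> S"
    then have "\<sigma> x \<in> S" using bij by (auto simp: bij_betw_def)
    then have "f x \<in> {1..k}" "f (\<sigma> x) \<in> {1..k}" using x f by auto
    then show "int (f (\<sigma> x)) - int (f x) \<le> (int k - 1) - (if f x > f (\<sigma> x) then int k else 0)"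
      by auto
  qed
  also have "\<dots> = int (card S) * (int k - 1) - int k * int (card ?D)"
    using fin by (simp add: sum_subtractf sum.If_cases Int_def)
  finally show ?thesis by simp
qed

definition cyclic_succ :: "nat \<Rightarrow> nat \<Rightarrow> nat" where
  "cyclic_succ n t = (if t = n then 1 else t + 1)"

lemma bij_betw_cyclic_succ: "bij_betw (cyclic_succ n) {1..n} {1..n}"
proof -
  have "inj_on (cyclic_succ n) {1..n}"
    by (auto simp: inj_on_def cyclic_succ_def split: if_splits)
  moreover have "cyclic_succ n ` {1..n} \<subseteq> {1..n}"
    by (auto simp: cyclic_succ_def)
  ultimately show ?thesis
    by (simp add: bij_betw_def endo_inj_surj)
qed

lemma cyclic_word_descents_le:
  fixes f :: "nat \<Rightarrow> nat"
  assumes "k \<ge> 1" and "f \<in> {1..n} \<rightarrow> {1..k}"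
  shows "int (card {t \<in> {1..n}. f t > f (cyclic_succ n t)}) \<le> \<lfloor>real n * (real k - 1) / real k\<rfloor>"
    (is "int ?D \<le> _")
proof -
  have "int k * int ?D \<le> int n * (int k - 1)"
    using permutation_descents_bound[OF _ bij_betw_cyclic_succ assms(2)] by simp
  then have "real_of_int (int k * int ?D) \<le> real_of_int (int n * (int k - 1))"
    by (simp only: of_int_le_iff)
  then have "real ?D \<le> real n * (real k - 1) / real k"
    using assms(1) by (simp add: field_simps)
  then show ?thesis by (simp add: le_floor_iff)
qed

text \<open>
  Along a fixed direction, ordinary and cyclic descents are both given by their first
  position alone.
\<close>

definition dir_descents ::
  "nat \<Rightarrow> (nat \<Rightarrow> nat) \<Rightarrow> ((nat \<Rightarrow> nat) \<Rightarrow> nat) \<Rightarrow> nat \<Rightarrow> (nat \<Rightarrow> nat) set" where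
  "dir_descents d m w l = {i \<in> positions d m. w i > w (i(l := cyclic_succ (m l) (i l)))}"

lemma finite_dir_descents: "finite (dir_descents d m w l)"
  by (simp add: dir_descents_def positions_def finite_PiE)

lemma cycdes_le_sum_dir_descents:
  "cycdes d m w \<le> (\<Sum>l\<in>{1..d}. card (dir_descents d m w l))"
proof -
  define pair where "pair l i = (i, i(l := cyclic_succ (m l) (i l)))" for l and i :: "nat \<Rightarrow> nat"
  \<comment> \<open>A move in direction \<open>l\<close> wraps around exactly when it starts at \<open>i l = m l\<close>.\<close>
  define A where "A l = {i \<in> dir_descents d m w l. i l \<noteq> m l}" for l
  define B where "B l = {i \<in> dir_descents d m w l. i l = m l}" for l
  have fin: "finite (A l)" "finite (B l)" for l
    using finite_dir_descents by (simp_all add: A_def B_def)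
  have card_le: "card (\<Union>l\<in>{1..d}. pair l ` C l) \<le> (\<Sum>l\<in>{1..d}. card (C l))"
    if "\<And>l. finite (C l)" for C
    by (rule order_trans[OF card_UN_le sum_mono]) (auto intro: card_image_le that)
  have "descents d m w \<subseteq> (\<Union>l\<in>{1..d}. pair l ` A l)"
  proof
    fix p assume "p \<in> descents d m w"
    then obtain i j l where p: "p = (i, j)" "i \<in> positions d m" "j \<in> positions d m" "w i > w j"
        "l \<in> {1..d}" "j = i(l := i l + 1)"
      by (auto simp: descents_def)
    have "j l \<in> {1..m l}" using p(3,5) by (auto simp: positions_def)
    then have "i l \<noteq> m l" using p(6) by auto
    then have "i \<in> A l" "p = pair l i"
      using p by (auto simp: A_def pair_def dir_descents_def cyclic_succ_def)
    then show "p \<in> (\<Union>l\<in>{1..d}. pair l ` A l)" using p(5) by blast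
  qed
  then have desc: "card (descents d m w) \<le> (\<Sum>l\<in>{1..d}. card (A l))"
    using fin by (intro order_trans[OF card_mono card_le]) auto
  have "cyclic_descents d m w \<subseteq> (\<Union>l\<in>{1..d}. pair l ` B l)"
  proof
    fix p assume "p \<in> cyclic_descents d m w"
    then obtain i j l where p: "p = (i, j)" "i \<in> positions d m" "j \<in> positions d m" "w i > w j"
        "l \<in> {1..d}" "i l = m l" "j l = 1" "\<forall>r\<in>{1..d} - {l}. i r = j r"
      by (auto simp: cyclic_descents_def)
    have "j = i(l := 1)"
    proof (rule PiE_ext)
      show "j \<in> (\<Pi>\<^sub>E l\<in>{1..d}. UNIV)" using p(3) by (auto simp: positions_def PiE_iff)
      show "i(l := 1) \<in> (\<Pi>\<^sub>E l\<in>{1..d}. UNIV)"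
        using p(2,5) by (auto simp: positions_def PiE_iff extensional_def)
    qed (use p in auto)
    then have "i \<in> B l" "p = pair l i"
      using p by (auto simp: B_def pair_def dir_descents_def cyclic_succ_def)
    then show "p \<in> (\<Union>l\<in>{1..d}. pair l ` B l)" using p(5) by blast
  qed
  then have cyc: "card (cyclic_descents d m w) \<le> (\<Sum>l\<in>{1..d}. card (B l))"
    using fin by (intro order_trans[OF card_mono card_le]) auto
  have "card (A l) + card (B l) = card (dir_descents d m w l)" for l
  proof -
    have "dir_descents d m w l = A l \<union> B l" "A l \<inter> B l = {}" by (auto simp: A_def B_def)
    then show ?thesis using fin by (simp add: card_Un_disjoint)
  qed
  then have "(\<Sum>l\<in>{1..d}. card (A l)) + (\<Sum>l\<in>{1..d}. card (B l)) =
      (\<Sum>l\<in>{1..d}. card (dir_descents d m w l))"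
    by (simp only: flip: sum.distrib)
  then show ?thesis
    using desc cyc unfolding cycdes_def by linarith
qed

text \<open>
  A line in direction \<open>l\<close> is represented by the common coordinates of its points, a tuple indexed by
  \<open>{1..d} - {l}\<close>; the point of the line \<open>p\<close> at height \<open>t\<close> is \<open>p(l := t)\<close>.
\<close>

lemma card_dir_descents_le:
  assumes "k \<ge> 1" and l: "l \<in> {1..d}" and w: "w \<in> tensor_words d m k"
  shows "int (card (dir_descents d m w l)) \<le>
    (\<Prod>r\<in>{1..d} - {l}. int (m r)) * \<lfloor>real (m l) * (real k - 1) / real k\<rfloor>"
proof -
  let ?L = "\<Pi>\<^sub>E r\<in>{1..d} - {l}. {1..m r}"
  define T where
    "T p = {t \<in> {1..m l}. w (p(l := t)) > w (p(l := cyclic_succ (m l) t))}" for p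
  have finL: "finite ?L" by (simp add: finite_PiE)
  have finT: "finite (T p)" for p by (simp add: T_def)
  have "dir_descents d m w l \<subseteq> (\<Union>p\<in>?L. (\<lambda>t. p(l := t)) ` T p)"
  proof
    fix i assume i: "i \<in> dir_descents d m w l"
    \<comment> \<open>Extensional tuples that omit the index \<open>l\<close> have the value \<open>undefined\<close> there.\<close>
    define p where "p = i(l := undefined)"
    have "p \<in> ?L" using i
      by (auto simp: p_def dir_descents_def positions_def PiE_iff extensional_def)
    moreover have "i = p(l := i l)" by (simp add: p_def)
    moreover have "i l \<in> T p" using i l
      by (auto simp: T_def p_def dir_descents_def positions_def)
    ultimately show "i \<in> (\<Union>p\<in>?L. (\<lambda>t. p(l := t)) ` T p)" by blast
  qed
  then have "card (dir_descents d m w l) \<le> card (\<Union>p\<in>?L. (\<lambda>t. p(l := t)) ` T p)"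
    using finL finT by (intro card_mono) auto
  also have "\<dots> \<le> (\<Sum>p\<in>?L. card (T p))"
    by (rule order_trans[OF card_UN_le[OF finL] sum_mono]) (auto intro: card_image_le finT)
  finally have "int (card (dir_descents d m w l)) \<le> (\<Sum>p\<in>?L. int (card (T p)))"
    by (simp flip: of_nat_sum)
  also have "\<dots> \<le> int (card ?L) * \<lfloor>real (m l) * (real k - 1) / real k\<rfloor>"
  proof (rule sum_bounded_above)
    fix p assume p: "p \<in> ?L"
    have "p(l := t) \<in> positions d m" if "t \<in> {1..m l}" for t
      using p l that by (auto simp: positions_def PiE_iff extensional_def)
    then have "(\<lambda>t. w (p(l := t))) \<in> {1..m l} \<rightarrow> {1..k}"
      using w by (auto simp: tensor_words_def PiE_iff)
    then show "int (card (T p)) \<le> \<lfloor>real (m l) * (real k - 1) / real k\<rfloor>"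
      unfolding T_def by (rule cyclic_word_descents_le[OF \<open>k \<ge> 1\<close>])
  qed
  also have "int (card ?L) = (\<Prod>r\<in>{1..d} - {l}. int (m r))"
    by (simp add: card_PiE)
  finally show ?thesis .
qed

theorem corollary9:
  fixes k d :: nat and m :: "nat \<Rightarrow> nat" and w :: "(nat \<Rightarrow> nat) \<Rightarrow> nat"
  assumes "k \<ge> 1" and "d \<ge> 1"
    and "\<forall>l\<in>{1..d}. m l \<ge> 1"
    and "w \<in> tensor_words d m k"
  shows "int (cycdes d m w) \<le>
    (\<Sum>i\<in>{1..d}. (\<Prod>l\<in>{1..d} - {i}. int (m l)) * \<lfloor>real (m i) * (real k - 1) / real k\<rfloor>)"
proof -
  have "int (cycdes d m w) \<le> (\<Sum>l\<in>{1..d}. int (card (dir_descents d m w l)))"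
    using cycdes_le_sum_dir_descents[of d m w] by (simp flip: of_nat_sum)
  also have "\<dots> \<le>
    (\<Sum>i\<in>{1..d}. (\<Prod>l\<in>{1..d} - {i}. int (m l)) * \<lfloor>real (m i) * (real k - 1) / real k\<rfloor>)"
    by (intro sum_mono card_dir_descents_le assms)
  finally show ?thesis .
qed

end
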